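(* Let $Q_1,Q_2,Q_3:\mathbf{T}\to\mathbb{R}$ be continuous potentials such that for some $a\in(0,1)$, $$aQ_1(e^{ix})+(1-a)Q_2(e^{iy})\ge Q_3\big(e^{i(ax+(1-a)y)}\big)\quad\text{for all }x,y\in\mathbb{R}.$$ Then $$aE_{Q_1}(\mu_{Q_1})+(1-a)E_{Q_2}(\mu_{Q_2})\ge E_{Q_3}(\mu_{Q_3}).$$
   Context: $\mathbf{T}$ is the unit circle in $\mathbb{C}$. For a continuous $Q:\mathbf{T}\to\mathbb{R}$ (a potential) and a probability measure $\mu$ on $\mathbf{T}$, $E_Q(\mu)=\int Q\,d\mu-\iint\log|x-y|\,\mu(dx)\mu(dy)$; $\mu_Q$ denotes the (unique) minimizer of $E_Q$ over probability measures on $\mathbf{T}$. *)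

theory Defs
  imports "HOL-Probability.Probability"
begin

abbreviation unit_circle :: "complex set" where
  "unit_circle \<equiv> sphere 0 1"

definition circle_prob :: "complex measure set" where
  "circle_prob = {\<mu>. prob_space \<mu> \<and> sets \<mu> = sets (restrict_space borel unit_circle)}"

text \<open>
  The integral of an extended-real function, as the integral of the positive part minus that of
  the negative part (\<open>e2ennreal\<close> sends negative values to \<open>0\<close>). It is meaningful when at least one
  of the two parts has a finite integral; this is the case below, since \<open>log |x - y| \<le> log 2\<close> on
  the circle.
\<close>
definition ereal_integral :: "'a measure \<Rightarrow> ('a \<Rightarrow> ereal) \<Rightarrow> ereal" where
  "ereal_integral M f =
     enn2ereal (\<integral>\<^sup>+ x. e2ennreal (f x) \<partial>M) - enn2ereal (\<integral>\<^sup>+ x. e2ennreal (- f x) \<partial>M)"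

text \<open>
  The real function \<open>ln\<close> satisfies \<open>ln 0 = 0\<close>, whereas the energy needs \<open>log 0 = -\<infinity>\<close>; otherwise
  atoms would not be penalised.
\<close>
definition log_kernel :: "complex \<Rightarrow> complex \<Rightarrow> ereal" where
  "log_kernel x y = (if x = y then - \<infinity> else ereal (ln (cmod (x - y))))"

definition energy :: "(complex \<Rightarrow> real) \<Rightarrow> complex measure \<Rightarrow> ereal" where
  "energy Q \<mu> = ereal (\<integral>x. Q x \<partial>\<mu>) - ereal_integral (\<mu> \<Otimes>\<^sub>M \<mu>) (\<lambda>(x, y). log_kernel x y)"

text \<open>
  For continuous \<open>Q\<close> the minimizer exists and is unique, so the choice made by \<open>arg_min_on\<close> is
  immaterial.
\<close>
definition equilibrium_measure :: "(complex \<Rightarrow> real) \<Rightarrow> complex measure" where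
  "equilibrium_measure Q = arg_min_on (energy Q) circle_prob"

end

theory Submission
  imports Defs
begin

text \<open>
  Lift the minimizers of the first two energies to laws of \<open>cis (X \<omega>)\<close> and \<open>cis (Y \<omega>)\<close>, where
  \<open>X\<close> and \<open>Y\<close> are quantile functions on \<open>(0, 1)\<close> with values in \<open>[-\<pi>, \<pi>]\<close>, and compare with the
  law of \<open>cis (a X + (1 - a) Y)\<close>. As \<open>X\<close> and \<open>Y\<close> are comonotone, the increments
  \<open>X s - X t\<close> and \<open>Y s - Y t\<close> have the same sign and modulus at most \<open>2\<pi>\<close>. Since
  \<open>|cis u - cis v| = 2 |sin ((u - v) / 2)|\<close> and \<open>log sin\<close> is concave on \<open>(0, \<pi>)\<close>, the logarithmic
  energy of the combination is at most the combination of the logarithmic energies; the potentials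
  are compared pointwise by the hypothesis.

  Minimizers exist by the direct method: a minimizing sequence, read as laws of angles, has a weakly
  convergent subsequence, and Skorohod's representation turns lower semicontinuity of the energy
  into Fatou's lemma.
\<close>


section \<open>The shifted kernel and the extended-real integral\<close>

abbreviation circle_borel :: "complex measure" where
  "circle_borel \<equiv> restrict_space borel unit_circle"

text \<open>The shift by \<open>ln 2\<close>, the log-diameter of the circle, makes the kernel nonnegative there, so
  that \<open>ennreal\<close> truncates nothing.\<close>
definition energy_kernel :: "complex \<Rightarrow> complex \<Rightarrow> ennreal" where
  "energy_kernel x y = (if x = y then \<infinity> else ennreal (ln 2 - ln (cmod (x - y))))"

lemma measurable_energy_kernel [measurable]:
  "(\<lambda>(x, y). energy_kernel x y) \<in> borel_measurable (borel \<Otimes>\<^sub>M borel)"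
  unfolding energy_kernel_def by measurable

lemma measurable_log_kernel [measurable]:
  "(\<lambda>(x, y). log_kernel x y) \<in> borel_measurable (borel \<Otimes>\<^sub>M borel)"
  unfolding log_kernel_def by measurable

lemma e2ennreal_log_kernel:
  "e2ennreal (ereal (ln 2) - log_kernel x y) = energy_kernel x y"
  by (auto simp: log_kernel_def energy_kernel_def)

lemma log_kernel_le:
  "x \<in> unit_circle \<Longrightarrow> y \<in> unit_circle \<Longrightarrow> log_kernel x y \<le> ereal (ln 2)"
  using norm_triangle_ineq4[of x y] by (auto simp: log_kernel_def)

text \<open>This is \<open>c - f = c + f\<^sup>- - f\<^sup>+\<close> with the positive part moved to
  the left, so that no truncating subtraction in \<open>ennreal\<close> occurs and
  \<open>f = -\<infinity>\<close> is covered.\<close>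

lemma e2ennreal_diff_add:
  assumes "f \<le> ereal c" "c \<ge> 0"
  shows "e2ennreal (ereal c - f) + e2ennreal f = ennreal c + e2ennreal (- f)"
proof (cases f)
  case (real r)
  then show ?thesis using assms
    by (cases "r \<ge> 0") (auto simp: ennreal_neg e2ennreal_neg ennreal_plus[symmetric] simp del: ennreal_plus)
qed (use assms in auto)

text \<open>The upper bound makes the integral of the positive part finite, so the defining
  difference is never \<open>\<infinity> - \<infinity>\<close> and can be regrouped. The logarithmic
  energy thereby reduces to a single nonnegative integral, to which monotonicity and Fatou
  apply.\<close>

lemma ereal_integral_bounded_above:
  assumes "prob_space M" and [measurable]: "f \<in> borel_measurable M"
    and le: "\<And>x. x \<in> space M \<Longrightarrow> f x \<le> ereal c" and "0 \<le> c"
  shows "ereal_integral M f = ereal c - enn2ereal (\<integral>\<^sup>+ x. e2ennreal (ereal c - f x) \<partial>M)"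
proof -
  interpret prob_space M by fact
  define P N R where "P = (\<integral>\<^sup>+ x. e2ennreal (f x) \<partial>M)" and "N = (\<integral>\<^sup>+ x. e2ennreal (- f x) \<partial>M)"
    and "R = (\<integral>\<^sup>+ x. e2ennreal (ereal c - f x) \<partial>M)"
  have "R + P = (\<integral>\<^sup>+ x. e2ennreal (ereal c - f x) + e2ennreal (f x) \<partial>M)"
    unfolding R_def P_def by (rule nn_integral_add[symmetric]) auto
  also have "\<dots> = (\<integral>\<^sup>+ x. ennreal c + e2ennreal (- f x) \<partial>M)"
    by (rule nn_integral_cong) (simp add: e2ennreal_diff_add le \<open>0 \<le> c\<close>)
  also have "\<dots> = ennreal c + N"
    unfolding N_def by (subst nn_integral_add) (auto simp: emeasure_space_1)
  finally have eq: "R + P = ennreal c + N" .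
  have "P \<le> (\<integral>\<^sup>+ x. ennreal c \<partial>M)"
    unfolding P_def
    by (intro nn_integral_mono) (use le in \<open>auto simp: e2ennreal_mono simp flip: e2ennreal_ereal\<close>)
  then have "P \<le> ennreal c" by (simp add: emeasure_space_1)
  then obtain p where p: "0 \<le> p" "P = ennreal p"
    using ennreal_cases le_ennreal_iff \<open>0 \<le> c\<close> by metis
  have "enn2ereal (R + P) = enn2ereal (ennreal c + N)" by (simp only: eq)
  then have "enn2ereal R + ereal p = ereal c + enn2ereal N"
    using p \<open>0 \<le> c\<close> by (simp add: plus_ennreal.rep_eq enn2ereal_ennreal)
  \<comment> \<open>The preceding equation forces \<open>R\<close> and \<open>N\<close> to be
    infinite together, since \<open>p\<close> and \<open>c\<close> are real; in that case both sides
    are \<open>-\<infinity>\<close>.\<close>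
  then have "ereal p - enn2ereal N = ereal c - enn2ereal R"
    by (cases "enn2ereal R"; cases "enn2ereal N") auto
  then show ?thesis
    using p unfolding ereal_integral_def P_def[symmetric] N_def[symmetric] R_def[symmetric]
    by (simp add: enn2ereal_ennreal)
qed

text \<open>The kernel is continuous into \<open>[0, \<infinity>]\<close> even on the diagonal,
  because its value there is \<open>\<infinity>\<close> and the logarithm diverges. This supplies
  the pointwise limit for Fatou.\<close>

lemma tendsto_energy_kernel:
  assumes "u \<longlonglongrightarrow> x" "v \<longlonglongrightarrow> y"
  shows "(\<lambda>n. energy_kernel (u n) (v n)) \<longlonglongrightarrow> energy_kernel x y"
proof -
  have d: "(\<lambda>n. u n - v n) \<longlonglongrightarrow> x - y" using assms by (intro tendsto_intros)
  show ?thesis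
  proof (cases "x = y")
    case False
    have ev: "\<forall>\<^sub>F n in sequentially. u n - v n \<noteq> 0"
      using False d by (intro tendsto_imp_eventually_ne[where c = "x - y"]) auto
    have "(\<lambda>n. ennreal (ln 2 - ln (cmod (u n - v n)))) \<longlonglongrightarrow> ennreal (ln 2 - ln (cmod (x - y)))"
      by (intro tendsto_ennrealI tendsto_diff tendsto_const tendsto_ln tendsto_norm d) (use False in auto)
    moreover have "\<forall>\<^sub>F n in sequentially.
        ennreal (ln 2 - ln (cmod (u n - v n))) = energy_kernel (u n) (v n)"
      using ev by eventually_elim (auto simp: energy_kernel_def)
    ultimately show ?thesis
      using False by (subst energy_kernel_def) (auto intro: Lim_transform_eventually)
  next
    case True
    have "\<forall>\<^sub>F n in sequentially. ennreal l < energy_kernel (u n) (v n)" if "l \<ge> 0" for l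
    proof -
      \<comment> \<open>The radius solves \<open>ln 2 - ln d = l\<close> for the distance
        \<open>d\<close>: closer pairs have kernel above \<open>l\<close>.\<close>
      have "\<forall>\<^sub>F n in sequentially. cmod (u n - v n) < exp (ln 2 - l)"
        using tendsto_norm[OF d] True by (intro order_tendstoD(2)) auto
      then show ?thesis
      proof eventually_elim
        case (elim n)
        then have "ln (cmod (u n - v n)) < ln 2 - l" if "u n \<noteq> v n"
          using that by (metis exp_gt_zero ln_exp ln_less_cancel_iff right_minus_eq zero_less_norm_iff)
        then show ?case
          using \<open>l \<ge> 0\<close> by (auto simp: energy_kernel_def ennreal_less_iff)
      qed
    qed
    then show ?thesis
      using True by (simp add: energy_kernel_def[of y y] tendsto_top_iff_ennreal)
  qed
qed

section \<open>Measures on the circle as laws of angles\<close>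

lemma measurable_cis [measurable]: "cis \<in> borel \<rightarrow>\<^sub>M circle_borel"
  by (auto simp: measurable_restrict_space2_iff continuous_on_cis intro!: borel_measurable_continuous_onI continuous_intros)

text \<open>On the circle \<open>Arg\<close> jumps only at \<open>-1\<close>, and a countable
  exceptional set does not affect measurability.\<close>

lemma measurable_Arg: "Arg \<in> borel_measurable circle_borel"
proof -
  have "continuous_on (sphere 0 1 - {-1}) Arg"
    by (rule continuous_on_subset[OF continuous_on_Arg]) (auto elim!: nonpos_Reals_cases)
  then have 1: "Arg \<in> borel_measurable (restrict_space borel (sphere 0 1 - {-1}))"
    by (rule borel_measurable_continuous_on_restrict)
  show ?thesis
  proof (rule measurable_restrict_countable[where X = "{-1}"])
    show "Arg \<in> borel_measurable (restrict_space circle_borel (- {-1}))"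
      using 1 by (simp add: restrict_restrict_space Diff_eq)
  qed (auto simp: sets_restrict_space_iff)
qed

lemma law_mem_circle_prob:
  assumes "prob_space \<Omega>" "Y \<in> borel_measurable \<Omega>"
  shows "distr \<Omega> circle_borel (\<lambda>\<omega>. cis (Y \<omega>)) \<in> circle_prob"
  using assms by (auto simp: circle_prob_def intro!: prob_space.prob_space_distr)

text \<open>Push forward by \<open>Arg\<close> and back by \<open>cis\<close>: the composition is
  the identity on the circle. Passing to the line makes tightness, Skorohod representation and
  quantiles available.\<close>

lemma circle_prob_eq_law:
  assumes "\<mu> \<in> circle_prob"
  obtains M where "real_distribution M" "AE x in M. x \<in> {-pi<..pi}" "\<mu> = distr M circle_borel cis"
proof
  interpret prob_space \<mu> using assms by (simp add: circle_prob_def)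
  have [measurable_cong]: "sets \<mu> = sets circle_borel" using assms by (simp add: circle_prob_def)
  have sp: "space \<mu> = unit_circle" using sets_eq_imp_space_eq[OF \<open>sets \<mu> = _\<close>] by simp
  note [measurable] = measurable_Arg
  let ?M = "distr \<mu> borel Arg"
  show "real_distribution ?M"
    by (auto simp: real_distribution_def real_distribution_axioms_def intro!: prob_space_distr)
  show "AE x in ?M. x \<in> {-pi<..pi}"
    by (subst AE_distr_iff) (use Arg_bounded in auto)
  have "distr ?M circle_borel cis = distr \<mu> circle_borel (cis \<circ> Arg)"
    by (rule distr_distr) auto
  also have "\<dots> = distr \<mu> \<mu> (\<lambda>x. x)"
  proof (rule distr_cong)
    fix x assume "x \<in> space \<mu>"
    then have "cmod x = 1" by (simp add: sp)
    then show "(cis \<circ> Arg) x = x" by (subst o_apply, subst cis_Arg) (auto simp: sgn_div_norm)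
  qed (use \<open>sets \<mu> = _\<close> in auto)
  also have "\<dots> = \<mu>" by (simp add: distr_id2)
  finally show "\<mu> = distr ?M circle_borel cis" ..
qed

lemma continuous_on_circle_bounded:
  fixes Q :: "complex \<Rightarrow> real"
  assumes "continuous_on unit_circle Q"
  obtains B where "\<And>x. \<bar>Q (cis x)\<bar> \<le> B"
proof -
  have "compact (Q ` unit_circle)" by (intro compact_continuous_image assms) simp
  then have "bounded (Q ` unit_circle)" by (rule compact_imp_bounded)
  then obtain B where "\<And>y. y \<in> Q ` unit_circle \<Longrightarrow> norm y \<le> B" by (auto simp: bounded_iff)
  then show thesis by (intro that[of B]) auto
qed

lemma continuous_on_compose_cis:
  fixes Q :: "complex \<Rightarrow> real"
  assumes "continuous_on unit_circle Q"
  shows "continuous_on UNIV (\<lambda>x. Q (cis x))"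
  by (rule continuous_on_compose2[OF assms]) (auto intro!: continuous_intros)

text \<open>Several circle measures can be laws on the same \<open>\<Omega>\<close>, so their
  energies can be compared by comparing integrands. The term \<open>- ln 2\<close> undoes the shift
  in \<open>energy_kernel\<close>.\<close>

lemma energy_law:
  assumes "prob_space \<Omega>" and [measurable]: "Y \<in> borel_measurable \<Omega>"
    and Q: "continuous_on unit_circle Q"
  shows "energy Q (distr \<Omega> circle_borel (\<lambda>\<omega>. cis (Y \<omega>))) =
    ereal ((\<integral>\<omega>. Q (cis (Y \<omega>)) \<partial>\<Omega>) - ln 2)
      + enn2ereal (\<integral>\<^sup>+ (s, t). energy_kernel (cis (Y s)) (cis (Y t)) \<partial>(\<Omega> \<Otimes>\<^sub>M \<Omega>))"
proof -
  interpret prob_space \<Omega> by fact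
  let ?X = "\<lambda>\<omega>. cis (Y \<omega>)"
  let ?\<mu> = "distr \<Omega> circle_borel ?X"
  interpret \<mu>: prob_space ?\<mu> by (rule prob_space_distr) measurable
  interpret \<mu>\<mu>: pair_prob_space ?\<mu> ?\<mu> ..
  have Qm: "Q \<in> borel_measurable circle_borel" by (rule borel_measurable_continuous_on_restrict[OF Q])
  \<comment> \<open>The kernels are Borel on the whole plane, while the law lives on the trace of
    the Borel sets on the circle; the inclusion transfers measurability.\<close>
  have id: "(\<lambda>x. x) \<in> circle_borel \<rightarrow>\<^sub>M borel" by (rule measurable_restrict_space1) simp
  have pair: "(\<lambda>(x, y). (x, y)) \<in> circle_borel \<Otimes>\<^sub>M circle_borel \<rightarrow>\<^sub>M borel \<Otimes>\<^sub>M borel"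
    using id by measurable
  have lm: "(\<lambda>(x, y). log_kernel x y) \<in> borel_measurable (circle_borel \<Otimes>\<^sub>M circle_borel)"
    using measurable_compose[OF pair measurable_log_kernel] by (simp add: case_prod_beta')
  have km: "(\<lambda>(x, y). energy_kernel x y) \<in> borel_measurable (circle_borel \<Otimes>\<^sub>M circle_borel)"
    using measurable_compose[OF pair measurable_energy_kernel] by (simp add: case_prod_beta')
  have "ereal_integral (?\<mu> \<Otimes>\<^sub>M ?\<mu>) (\<lambda>(x, y). log_kernel x y) =
    ereal (ln 2) - enn2ereal (\<integral>\<^sup>+ z. e2ennreal (ereal (ln 2) - (case z of (x, y) \<Rightarrow> log_kernel x y)) \<partial>(?\<mu> \<Otimes>\<^sub>M ?\<mu>))"
  proof (rule ereal_integral_bounded_above)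
    show "prob_space (?\<mu> \<Otimes>\<^sub>M ?\<mu>)" by unfold_locales
    show "(\<lambda>(x, y). log_kernel x y) \<in> borel_measurable (?\<mu> \<Otimes>\<^sub>M ?\<mu>)"
      using lm by (simp cong: measurable_cong_sets sets_pair_measure_cong)
  qed (auto simp: space_pair_measure intro!: log_kernel_le)
  also have "(\<lambda>z. e2ennreal (ereal (ln 2) - (case z of (x, y) \<Rightarrow> log_kernel x y))) = (\<lambda>(x, y). energy_kernel x y)"
    by (auto simp: e2ennreal_log_kernel)
  also have "(\<integral>\<^sup>+ (x, y). energy_kernel x y \<partial>(?\<mu> \<Otimes>\<^sub>M ?\<mu>)) =
      (\<integral>\<^sup>+ (s, t). energy_kernel (cis (Y s)) (cis (Y t)) \<partial>(\<Omega> \<Otimes>\<^sub>M \<Omega>))"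
  proof -
    have "?\<mu> \<Otimes>\<^sub>M ?\<mu> = distr (\<Omega> \<Otimes>\<^sub>M \<Omega>) (circle_borel \<Otimes>\<^sub>M circle_borel) (\<lambda>(s, t). (?X s, ?X t))"
    by (rule pair_measure_distr) (auto intro: \<mu>.sigma_finite_measure_axioms)
    then show ?thesis
      by (simp only:, subst nn_integral_distr) (use km in \<open>auto simp: case_prod_beta'\<close>)
  qed
  finally have J: "ereal_integral (?\<mu> \<Otimes>\<^sub>M ?\<mu>) (\<lambda>(x, y). log_kernel x y) = ereal (ln 2) -
    enn2ereal (\<integral>\<^sup>+ (s, t). energy_kernel (cis (Y s)) (cis (Y t)) \<partial>(\<Omega> \<Otimes>\<^sub>M \<Omega>))" .
  have "(\<integral>x. Q x \<partial>?\<mu>) = (\<integral>\<omega>. Q (cis (Y \<omega>)) \<partial>\<Omega>)"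
    by (rule integral_distr) (use Qm in auto)
  with J show ?thesis
    unfolding energy_def
    by (cases "enn2ereal (\<integral>\<^sup>+ (s, t). energy_kernel (cis (Y s)) (cis (Y t)) \<partial>(\<Omega> \<Otimes>\<^sub>M \<Omega>))") auto
qed

lemma measurable_kernel_law:
  assumes [measurable]: "Y \<in> borel_measurable \<Omega>"
  shows "(\<lambda>(s, t). energy_kernel (cis (Y s)) (cis (Y t))) \<in> borel_measurable (\<Omega> \<Otimes>\<^sub>M \<Omega>)"
proof -
  have [measurable]: "cis \<in> borel_measurable borel"
    by (intro borel_measurable_continuous_onI continuous_intros)
  have "(\<lambda>(s, t). (cis (Y s), cis (Y t))) \<in> \<Omega> \<Otimes>\<^sub>M \<Omega> \<rightarrow>\<^sub>M borel \<Otimes>\<^sub>M borel" by measurable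
  from measurable_compose[OF this measurable_energy_kernel] show ?thesis
    by (simp add: case_prod_beta')
qed


section \<open>Lower semicontinuity and existence of minimizers\<close>

lemma enn2ereal_liminf: "enn2ereal (liminf u) = liminf (\<lambda>n. enn2ereal (u n))" for u :: "nat \<Rightarrow> ennreal"
  by (rule Liminf_compose_continuous_mono[symmetric])
     (auto simp: continuous_on_enn2ereal mono_def less_eq_ennreal.rep_eq)

lemma tight_concentrated:
  assumes "\<And>n. real_distribution (M n)" "\<And>n. AE x in M n. x \<in> {a<..b}" "a < b"
  shows "tight M"
  unfolding tight_def
proof (intro conjI allI impI)
  fix \<epsilon> :: real assume "0 < \<epsilon>"
  have "measure (M n) {a<..b} = 1" for n
  proof -
    interpret real_distribution "M n" by (rule assms)
    show ?thesis using assms(2)[of n] by (subst prob_eq_1) auto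
  qed
  then show "\<exists>a b. a < b \<and> (\<forall>n. 1 - \<epsilon> < measure (M n) {a<..b})"
    using \<open>0 < \<epsilon>\<close> \<open>a < b\<close> by (intro exI[of _ a] exI[of _ b]) auto
qed (rule assms)

text \<open>The potential is bounded on the circle, so its integral converges by dominated
  convergence. The kernel is nonnegative and continuous, so Fatou bounds its integral.\<close>

lemma energy_law_le_liminf:
  assumes \<Omega>: "prob_space \<Omega>" and [measurable]: "\<And>n. Y n \<in> borel_measurable \<Omega>" "Z \<in> borel_measurable \<Omega>"
    and lim: "\<And>\<omega>. \<omega> \<in> space \<Omega> \<Longrightarrow> (\<lambda>n. Y n \<omega>) \<longlonglongrightarrow> Z \<omega>"
    and Q: "continuous_on unit_circle Q"
  shows "energy Q (distr \<Omega> circle_borel (\<lambda>\<omega>. cis (Z \<omega>)))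
    \<le> liminf (\<lambda>n. energy Q (distr \<Omega> circle_borel (\<lambda>\<omega>. cis (Y n \<omega>))))"
proof -
  interpret prob_space \<Omega> by fact
  let ?J = "\<lambda>X. \<integral>\<^sup>+ (s, t). energy_kernel (cis (X s)) (cis (X t)) \<partial>(\<Omega> \<Otimes>\<^sub>M \<Omega>)"
  let ?q = "\<lambda>X. (\<integral>\<omega>. Q (cis (X \<omega>)) \<partial>\<Omega>) - ln 2"
  obtain B where B: "\<And>x. \<bar>Q (cis x)\<bar> \<le> B" using continuous_on_circle_bounded[OF Q] by blast
  have Qc: "continuous_on UNIV (\<lambda>x. Q (cis x))" by (rule continuous_on_compose_cis[OF Q])
  note [measurable] = borel_measurable_continuous_onI[OF Qc]
  have cis_lim: "(\<lambda>n. cis (Y n \<omega>)) \<longlonglongrightarrow> cis (Z \<omega>)" if "\<omega> \<in> space \<Omega>" for \<omega>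
    using lim[OF that] by (intro tendsto_intros)
  have "(\<lambda>n. \<integral>\<omega>. Q (cis (Y n \<omega>)) \<partial>\<Omega>) \<longlonglongrightarrow> (\<integral>\<omega>. Q (cis (Z \<omega>)) \<partial>\<Omega>)"
  proof (rule integral_dominated_convergence[where w = "\<lambda>_. B"])
    show "AE \<omega> in \<Omega>. (\<lambda>n. Q (cis (Y n \<omega>))) \<longlonglongrightarrow> Q (cis (Z \<omega>))"
      by (intro AE_I2 continuous_on_tendsto_compose[OF Qc]) (auto simp: lim)
  qed (auto simp: B)
  then have q: "(\<lambda>n. ereal (?q (Y n))) \<longlonglongrightarrow> ereal (?q Z)"
    by (intro tendsto_ereal tendsto_diff tendsto_const)
  have "?J Z = (\<integral>\<^sup>+ p. liminf (\<lambda>n. case p of (s, t) \<Rightarrow> energy_kernel (cis (Y n s)) (cis (Y n t))) \<partial>(\<Omega> \<Otimes>\<^sub>M \<Omega>))"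
  proof (rule nn_integral_cong)
    fix p assume "p \<in> space (\<Omega> \<Otimes>\<^sub>M \<Omega>)"
    then obtain s t where p: "p = (s, t)" "s \<in> space \<Omega>" "t \<in> space \<Omega>" by (auto simp: space_pair_measure)
    show "(case p of (s, t) \<Rightarrow> energy_kernel (cis (Z s)) (cis (Z t))) =
      liminf (\<lambda>n. case p of (s, t) \<Rightarrow> energy_kernel (cis (Y n s)) (cis (Y n t)))"
      using tendsto_energy_kernel[OF cis_lim cis_lim, OF p(2,3)] p(1)
      by (simp add: lim_imp_Liminf)
  qed
  also have "\<dots> \<le> liminf (\<lambda>n. ?J (Y n))"
    by (rule nn_integral_liminf) (rule measurable_kernel_law, measurable)
  finally have "enn2ereal (?J Z) \<le> liminf (\<lambda>n. enn2ereal (?J (Y n)))"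
    by (simp add: enn2ereal_liminf[symmetric] less_eq_ennreal.rep_eq)
  then have "ereal (?q Z) + enn2ereal (?J Z) \<le> ereal (?q Z) + liminf (\<lambda>n. enn2ereal (?J (Y n)))"
    by (rule add_left_mono)
  \<comment> \<open>A convergent real sequence may be pulled into a \<open>liminf\<close> as a
    summand.\<close>
  also have "\<dots> = liminf (\<lambda>n. ereal (?q (Y n)) + enn2ereal (?J (Y n)))"
    by (rule ereal_liminf_lim_add[symmetric, OF q]) simp
  finally show ?thesis
    by (simp add: energy_law[OF \<Omega> _ Q])
qed

lemma circle_prob_nonempty: "circle_prob \<noteq> {}"
proof -
  have "distr (return borel 0) circle_borel (\<lambda>x. cis x) \<in> circle_prob"
    by (rule law_mem_circle_prob) (auto intro: prob_space_return)
  then show ?thesis by blast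
qed

lemma energy_minimizer_exists:
  assumes Q: "continuous_on unit_circle Q"
  obtains \<mu> where "\<mu> \<in> circle_prob" "\<And>\<nu>. \<nu> \<in> circle_prob \<Longrightarrow> energy Q \<mu> \<le> energy Q \<nu>"
proof -
  obtain e where e: "\<And>n::nat. e n \<in> energy Q ` circle_prob" "e \<longlonglongrightarrow> Inf (energy Q ` circle_prob)"
    using Inf_as_limit[of "energy Q ` circle_prob"] circle_prob_nonempty by auto
  have "\<exists>M. real_distribution M \<and> (AE x in M. x \<in> {-pi<..pi}) \<and> e n = energy Q (distr M circle_borel cis)" for n
    using e(1)[of n] by (metis (no_types, lifting) circle_prob_eq_law imageE)
  then obtain M where M: "\<And>n. real_distribution (M n)" "\<And>n. AE x in M n. x \<in> {-pi<..pi}"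
      "\<And>n. e n = energy Q (distr (M n) circle_borel cis)"
    by metis
  \<comment> \<open>All angle laws are carried by one bounded interval, so no mass escapes to
    infinity.\<close>
  have "tight M" by (rule tight_concentrated[OF M(1,2)]) simp
  from tight_imp_convergent_subsubsequence[OF this strict_mono_id]
  obtain r N where r: "strict_mono r" and N: "real_distribution N" and "weak_conv_m (M \<circ> id \<circ> r) N"
    by blast
  then have "weak_conv_m (\<lambda>n. M (r n)) N" by (simp add: comp_def)
  from Skorohod[OF M(1) N this] obtain \<Omega> :: "real measure" and Y Z where
    \<Omega>: "prob_space \<Omega>" and "\<forall>n. Y n \<in> borel_measurable \<Omega>" and "\<forall>n. distr \<Omega> borel (Y n) = M (r n)"
    and "Z \<in> \<Omega> \<rightarrow>\<^sub>M lborel" and "\<forall>\<omega>\<in>space \<Omega>. (\<lambda>n. Y n \<omega>) \<longlonglongrightarrow> Z \<omega>"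
    by blast
  then have Ym [measurable]: "\<And>n. Y n \<in> borel_measurable \<Omega>" and Y: "\<And>n. distr \<Omega> borel (Y n) = M (r n)"
    and Zm [measurable]: "Z \<in> borel_measurable \<Omega>"
    and lim: "\<And>\<omega>. \<omega> \<in> space \<Omega> \<Longrightarrow> (\<lambda>n. Y n \<omega>) \<longlonglongrightarrow> Z \<omega>"
    by auto
  \<comment> \<open>Mass may drift to the angle \<open>-\<pi>\<close> in the limit; this is
    harmless, since only \<open>cis (Z \<omega>)\<close> enters the energy.\<close>
  let ?\<mu> = "distr \<Omega> circle_borel (\<lambda>\<omega>. cis (Z \<omega>))"
  have er: "e (r n) = energy Q (distr \<Omega> circle_borel (\<lambda>\<omega>. cis (Y n \<omega>)))" for n
    unfolding M(3) Y[symmetric] by (subst distr_distr) (auto simp: comp_def)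
  have "energy Q ?\<mu> \<le> liminf (\<lambda>n. e (r n))"
    unfolding er by (rule energy_law_le_liminf[OF \<Omega> Ym Zm lim Q])
  also have "\<dots> = Inf (energy Q ` circle_prob)"
    using LIMSEQ_subseq_LIMSEQ[OF e(2) r] by (intro lim_imp_Liminf) (auto simp: comp_def)
  finally have "energy Q ?\<mu> \<le> energy Q \<nu>" if "\<nu> \<in> circle_prob" for \<nu>
    using that by (meson INF_lower order_trans)
  then show thesis using law_mem_circle_prob[OF \<Omega> Zm] that by blast
qed

text \<open>\<open>arg_min_on\<close> is a Hilbert choice, so the existence of some minimizer makes
  the chosen measure one.\<close>

lemma equilibrium_measure_minimizes:
  assumes "continuous_on unit_circle Q"
  shows "equilibrium_measure Q \<in> circle_prob"
    and "\<nu> \<in> circle_prob \<Longrightarrow> energy Q (equilibrium_measure Q) \<le> energy Q \<nu>"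
proof -
  obtain \<mu> where "\<mu> \<in> circle_prob" "\<And>\<nu>. \<nu> \<in> circle_prob \<Longrightarrow> energy Q \<mu> \<le> energy Q \<nu>"
    using energy_minimizer_exists[OF assms] by blast
  then have "is_arg_min (energy Q) (\<lambda>x. x \<in> circle_prob) \<mu>"
    by (auto simp: is_arg_min_linorder)
  then have "is_arg_min (energy Q) (\<lambda>x. x \<in> circle_prob) (equilibrium_measure Q)"
    unfolding equilibrium_measure_def arg_min_on_def arg_min_def by (rule someI)
  then show "equilibrium_measure Q \<in> circle_prob"
    and "\<nu> \<in> circle_prob \<Longrightarrow> energy Q (equilibrium_measure Q) \<le> energy Q \<nu>"
    by (auto simp: is_arg_min_linorder)
qed

section \<open>Convexity of the kernel in the angles\<close>

lemma cmod_cis_diff: "cmod (cis u - cis v) = 2 * \<bar>sin ((u - v) / 2)\<bar>"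
proof -
  have "(cmod (cis u - cis v))\<^sup>2 = (cos u - cos v)\<^sup>2 + (sin u - sin v)\<^sup>2"
    by (simp add: cmod_power2)
  also have "\<dots> = 2 - 2 * cos (u - v)"
    using sin_cos_squared_add[of u] sin_cos_squared_add[of v]
    by (simp add: power2_eq_square cos_diff algebra_simps)
  also have "\<dots> = (2 * \<bar>sin ((u - v) / 2)\<bar>)\<^sup>2"
  proof -
    have "2 * ((u - v) / 2) = u - v" by simp
    from cos_double_sin[of "(u - v) / 2", unfolded this] show ?thesis
      by (simp add: power_mult_distrib)
  qed
  finally show ?thesis
    by (rule power2_eq_imp_eq) auto
qed

text \<open>The factor 2 in the chord length cancels the shift \<open>ln 2\<close>, leaving minus
  the log-sine of half the angle difference.\<close>

lemma energy_kernel_cis: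
  "energy_kernel (cis u) (cis v) =
    (if sin (\<bar>u - v\<bar> / 2) = 0 then \<infinity> else ennreal (- ln \<bar>sin (\<bar>u - v\<bar> / 2)\<bar>))"
proof -
  have "\<bar>sin ((u - v) / 2)\<bar> = \<bar>sin (\<bar>u - v\<bar> / 2)\<bar>"
    by (smt (verit) minus_divide_left sin_minus)
  then have *: "cmod (cis u - cis v) = 2 * \<bar>sin (\<bar>u - v\<bar> / 2)\<bar>" by (simp add: cmod_cis_diff)
  then have "cis u = cis v \<longleftrightarrow> sin (\<bar>u - v\<bar> / 2) = 0" by auto
  then show ?thesis by (auto simp: energy_kernel_def * ln_mult)
qed

text \<open>The second derivative is \<open>1 / sin\<^sup>2 x\<close>, kept in the form given by the
  quotient rule, whose sign is evident.\<close>

lemma convex_on_neg_ln_sin: "convex_on {0<..<pi} (\<lambda>x. - ln (sin x))"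
proof (rule f''_ge0_imp_convex[where f' = "\<lambda>x. - (cos x / sin x)" and f'' = "\<lambda>x. (sin x * sin x + cos x * cos x) / (sin x * sin x)"])
  fix x :: real assume "x \<in> {0<..<pi}"
  then have s: "sin x > 0" by (auto intro: sin_gt_zero)
  show "((\<lambda>x. - ln (sin x)) has_real_derivative - (cos x / sin x)) (at x)"
    using s by (auto intro!: derivative_eq_intros)
  show "((\<lambda>x. - (cos x / sin x)) has_real_derivative
      (sin x * sin x + cos x * cos x) / (sin x * sin x)) (at x)"
    using s
    by (auto intro!: derivative_eq_intros simp: field_simps) (use sin_cos_squared_add3[of x] in algebra)
  show "0 \<le> (sin x * sin x + cos x * cos x) / (sin x * sin x)" by simp
qed simp

text \<open>Increments of equal sign make the half distances combine linearly. The triangle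
  inequality alone would not do, as \<open>- ln (sin x)\<close> is not monotone on
  \<open>(0, \<pi>)\<close>. The bound \<open>2 * pi\<close> keeps the half distances in
  \<open>[0, \<pi>]\<close>, where convexity holds.\<close>

lemma energy_kernel_cis_convex:
  assumes "0 < a" "a < 1" and "\<bar>x - x'\<bar> \<le> 2 * pi" "\<bar>y - y'\<bar> \<le> 2 * pi"
    and comon: "(x \<le> x' \<and> y \<le> y') \<or> (x' \<le> x \<and> y' \<le> y)"
  shows "energy_kernel (cis (a * x + (1 - a) * y)) (cis (a * x' + (1 - a) * y'))
    \<le> ennreal a * energy_kernel (cis x) (cis x') + ennreal (1 - a) * energy_kernel (cis y) (cis y')"
proof -
  define p q where "p = \<bar>x - x'\<bar> / 2" and "q = \<bar>y - y'\<bar> / 2"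
  have "\<bar>(a * x + (1 - a) * y) - (a * x' + (1 - a) * y')\<bar> = \<bar>a * (x - x') + (1 - a) * (y - y')\<bar>"
    by (simp add: algebra_simps)
  also have "\<dots> = a * \<bar>x - x'\<bar> + (1 - a) * \<bar>y - y'\<bar>"
    using comon
  proof
    assume *: "x \<le> x' \<and> y \<le> y'"
    then have "a * (x - x') \<le> 0" "(1 - a) * (y - y') \<le> 0"
      using assms(1,2) by (auto simp: mult_le_0_iff)
    moreover have "\<bar>x - x'\<bar> = x' - x" "\<bar>y - y'\<bar> = y' - y" using * by auto
    ultimately show ?thesis by (simp add: algebra_simps)
  next
    assume *: "x' \<le> x \<and> y' \<le> y"
    then have "a * (x - x') \<ge> 0" "(1 - a) * (y - y') \<ge> 0"
      using assms(1,2) by auto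
    with * show ?thesis by auto
  qed
  finally have d: "\<bar>(a * x + (1 - a) * y) - (a * x' + (1 - a) * y')\<bar> / 2 = a * p + (1 - a) * q"
    by (simp add: p_def q_def field_simps)
  have pq: "0 \<le> p" "p \<le> pi" "0 \<le> q" "q \<le> pi" using assms by (auto simp: p_def q_def)
  show ?thesis
  \<comment> \<open>If \<open>p\<close> or \<open>q\<close> is \<open>0\<close> or
    \<open>\<pi>\<close>, two points coincide on the circle and, both weights being positive, the
    right-hand side is infinite.\<close>
  proof (cases "sin p = 0 \<or> sin q = 0")
    case True
    then have top: "ennreal a * energy_kernel (cis x) (cis x') + ennreal (1 - a) * energy_kernel (cis y) (cis y') = \<infinity>"
      using assms(1,2) by (auto simp: energy_kernel_cis p_def[symmetric] q_def[symmetric] ennreal_mult_top)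
    show ?thesis unfolding top by simp
  next
    case False
    then have p: "p \<in> {0<..<pi}" and q: "q \<in> {0<..<pi}"
      using pq by (auto simp: less_le)
    have "a * p + (1 - a) * q \<in> {0<..<pi}"
      using convexD[of "{0<..<pi}" p q a "1 - a"] p q assms(1,2) by auto
    then have sr: "sin (a * p + (1 - a) * q) > 0" by (auto intro: sin_gt_zero)
    have sp: "sin p > 0" "sin q > 0" using p q by (auto intro: sin_gt_zero)
    \<comment> \<open>\<open>convex_onD\<close> puts its parameter on the second point, hence the
      instance \<open>1 - a\<close>.\<close>
    have "- ln (sin (a * p + (1 - a) * q)) \<le> a * (- ln (sin p)) + (1 - a) * (- ln (sin q))"
      using convex_onD[OF convex_on_neg_ln_sin, of "1 - a" p q] p q assms(1,2) by simp
    then have "ennreal (- ln (sin (a * p + (1 - a) * q)))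
        \<le> ennreal (a * (- ln (sin p)) + (1 - a) * (- ln (sin q)))"
      by (rule ennreal_leI)
    also have "\<dots> = ennreal (a * (- ln (sin p))) + ennreal ((1 - a) * (- ln (sin q)))"
      using sp assms(1,2) by (intro ennreal_plus mult_nonneg_nonneg) auto
    also have "\<dots> = ennreal a * ennreal (- ln (sin p)) + ennreal (1 - a) * ennreal (- ln (sin q))"
      using sp assms(1,2) by (subst (1 2) ennreal_mult) auto
    finally show ?thesis
      using sr sp by (simp add: energy_kernel_cis p_def[symmetric] q_def[symmetric] d)
  qed
qed

section \<open>Quantile coupling and comparison of energies\<close>

context cdf_distribution
begin

text \<open>By the equivalence of \<open>\<omega> \<le> C x\<close> and
  \<open>I \<omega> \<le> x\<close>, it suffices that \<open>C u = 1\<close> and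
  \<open>C l = 0\<close>. The latter holds because the interval excludes \<open>l\<close>.\<close>

lemma quantile_bounds:
  assumes AE: "AE x in M. x \<in> {l<..u}" and \<omega>: "0 < \<omega>" "\<omega> < 1"
  shows "l \<le> I \<omega>" and "I \<omega> \<le> u"
proof -
  have "C u = 1"
    using AE unfolding cdf_def by (subst prob_eq_1) (auto elim: eventually_mono)
  then show "I \<omega> \<le> u" using pseudoinverse[OF \<omega>, of u] \<omega> by simp
  have "C l = 0"
    using AE unfolding cdf_def by (subst prob_eq_0) (auto elim: eventually_mono)
  then show "l \<le> I \<omega>" using pseudoinverse[OF \<omega>, of l] \<omega> by linarith
qed

end

text \<open>The base space \<open>(0, 1)\<close> does not depend on \<open>\<mu>\<close>, so two
  circle measures become laws of two increasing functions on it, which is the comonotone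
  coupling.\<close>

lemma circle_prob_eq_quantile_law:
  assumes "\<mu> \<in> circle_prob"
  obtains Y where "Y \<in> borel_measurable (restrict_space lborel {0<..<1::real})"
    and "mono_on {0<..<1} Y" and "\<And>\<omega>. \<omega> \<in> {0<..<1} \<Longrightarrow> Y \<omega> \<in> {-pi..pi}"
    and "\<mu> = distr (restrict_space lborel {0<..<1::real}) circle_borel (\<lambda>\<omega>. cis (Y \<omega>))"
proof -
  obtain M where M: "real_distribution M" "AE x in M. x \<in> {-pi<..pi}" "\<mu> = distr M circle_borel cis"
    using circle_prob_eq_law[OF assms] by blast
  interpret cdf_distribution M using M(1) by (simp add: cdf_distribution_def)
  let ?\<Omega> = "restrict_space lborel {0<..<1::real}"
  have m: "I \<in> borel_measurable ?\<Omega>" using measurable_CI by (simp cong: measurable_cong_sets add: sets_restrict_space)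
  have "\<mu> = distr (distr ?\<Omega> borel I) circle_borel cis" by (simp only: distr_I_eq_M M(3))
  also have "\<dots> = distr ?\<Omega> circle_borel (\<lambda>\<omega>. cis (I \<omega>))"
    using m by (subst distr_distr) (auto simp: comp_def)
  finally show thesis
    using that[OF m mono_I] quantile_bounds[OF M(2)] by auto
qed

text \<open>Both parts of the energy satisfy the inequality before integration: the potentials by
  \<open>le\<close>, the kernel by convexity along comonotone pairs.\<close>

lemma energy_comonotone_combination:
  assumes \<Omega>: "prob_space \<Omega>" and [measurable]: "X \<in> borel_measurable \<Omega>" "Y \<in> borel_measurable \<Omega>"
    and XY: "\<And>\<omega>. \<omega> \<in> space \<Omega> \<Longrightarrow> X \<omega> \<in> {-pi..pi} \<and> Y \<omega> \<in> {-pi..pi}"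
    and comon: "\<And>s t. s \<in> space \<Omega> \<Longrightarrow> t \<in> space \<Omega> \<Longrightarrow> (X s \<le> X t \<and> Y s \<le> Y t) \<or> (X t \<le> X s \<and> Y t \<le> Y s)"
    and Q: "continuous_on unit_circle Q1" "continuous_on unit_circle Q2" "continuous_on unit_circle Q3"
    and a: "0 < a" "a < 1"
    and le: "\<And>x y. Q3 (cis (a * x + (1 - a) * y)) \<le> a * Q1 (cis x) + (1 - a) * Q2 (cis y)"
  shows "energy Q3 (distr \<Omega> circle_borel (\<lambda>\<omega>. cis (a * X \<omega> + (1 - a) * Y \<omega>)))
    \<le> ereal a * energy Q1 (distr \<Omega> circle_borel (\<lambda>\<omega>. cis (X \<omega>)))
      + ereal (1 - a) * energy Q2 (distr \<Omega> circle_borel (\<lambda>\<omega>. cis (Y \<omega>)))"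
proof -
  interpret prob_space \<Omega> by fact
  let ?Z = "\<lambda>\<omega>. a * X \<omega> + (1 - a) * Y \<omega>"
  let ?J = "\<lambda>X. \<integral>\<^sup>+ (s, t). energy_kernel (cis (X s)) (cis (X t)) \<partial>(\<Omega> \<Otimes>\<^sub>M \<Omega>)"
  let ?q = "\<lambda>Q X. \<integral>\<omega>. Q (cis (X \<omega>)) \<partial>\<Omega>"
  have int: "integrable \<Omega> (\<lambda>\<omega>. Q (cis (X \<omega>)))"
    if "continuous_on unit_circle Q" and [measurable]: "X \<in> borel_measurable \<Omega>"
    for Q :: "complex \<Rightarrow> real" and X
  proof -
    obtain B where "\<And>x. \<bar>Q (cis x)\<bar> \<le> B" using continuous_on_circle_bounded[OF \<open>continuous_on unit_circle Q\<close>] by blast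
    moreover note [measurable] = borel_measurable_continuous_onI[OF continuous_on_compose_cis[OF \<open>continuous_on unit_circle Q\<close>]]
    ultimately show ?thesis by (intro integrable_const_bound[where B = B]) auto
  qed
  have "?q Q3 ?Z \<le> (\<integral>\<omega>. a * Q1 (cis (X \<omega>)) + (1 - a) * Q2 (cis (Y \<omega>)) \<partial>\<Omega>)"
  proof (rule integral_mono)
    show "integrable \<Omega> (\<lambda>\<omega>. a * Q1 (cis (X \<omega>)) + (1 - a) * Q2 (cis (Y \<omega>)))"
      by (rule Bochner_Integration.integrable_add; rule integrable_mult_right; rule int) (use Q in auto)
  qed (use int[OF Q(3)] le in auto)
  also have "\<dots> = a * ?q Q1 X + (1 - a) * ?q Q2 Y"
    by (simp add: int Q)
  \<comment> \<open>The constant \<open>ln 2\<close> fits on both sides because the weights sum to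
    1.\<close>
  finally have q: "?q Q3 ?Z - ln 2 \<le> a * (?q Q1 X - ln 2) + (1 - a) * (?q Q2 Y - ln 2)"
    by (simp add: algebra_simps)
  have "?J ?Z \<le> (\<integral>\<^sup>+ p. ennreal a * (case p of (s, t) \<Rightarrow> energy_kernel (cis (X s)) (cis (X t)))
      + ennreal (1 - a) * (case p of (s, t) \<Rightarrow> energy_kernel (cis (Y s)) (cis (Y t))) \<partial>(\<Omega> \<Otimes>\<^sub>M \<Omega>))"
  proof (rule nn_integral_mono)
    fix p assume "p \<in> space (\<Omega> \<Otimes>\<^sub>M \<Omega>)"
    then obtain s t where p: "p = (s, t)" "s \<in> space \<Omega>" "t \<in> space \<Omega>" by (auto simp: space_pair_measure)
    have "\<bar>X s - X t\<bar> \<le> 2 * pi" "\<bar>Y s - Y t\<bar> \<le> 2 * pi" using XY[OF p(2)] XY[OF p(3)] by auto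
    from energy_kernel_cis_convex[OF a this comon[OF p(2,3)]]
    show "(case p of (s, t) \<Rightarrow> energy_kernel (cis (?Z s)) (cis (?Z t)))
      \<le> ennreal a * (case p of (s, t) \<Rightarrow> energy_kernel (cis (X s)) (cis (X t)))
      + ennreal (1 - a) * (case p of (s, t) \<Rightarrow> energy_kernel (cis (Y s)) (cis (Y t)))"
      by (simp add: p(1))
  qed
  also have "\<dots> = ennreal a * ?J X + ennreal (1 - a) * ?J Y"
  proof -
    have linear: "(\<integral>\<^sup>+ p. ennreal a * f p + ennreal (1 - a) * g p \<partial>(\<Omega> \<Otimes>\<^sub>M \<Omega>)) =
        ennreal a * integral\<^sup>N (\<Omega> \<Otimes>\<^sub>M \<Omega>) f + ennreal (1 - a) * integral\<^sup>N (\<Omega> \<Otimes>\<^sub>M \<Omega>) g"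
      if [measurable]: "f \<in> borel_measurable (\<Omega> \<Otimes>\<^sub>M \<Omega>)" "g \<in> borel_measurable (\<Omega> \<Otimes>\<^sub>M \<Omega>)" for f g
      by (simp add: nn_integral_add nn_integral_cmult)
    show ?thesis by (intro linear measurable_kernel_law) measurable
  qed
  finally have "enn2ereal (?J ?Z) \<le> enn2ereal (ennreal a * ?J X + ennreal (1 - a) * ?J Y)"
    by (simp add: less_eq_ennreal.rep_eq)
  then have J: "enn2ereal (?J ?Z) \<le> ereal a * enn2ereal (?J X) + ereal (1 - a) * enn2ereal (?J Y)"
    using a by (simp add: plus_ennreal.rep_eq times_ennreal.rep_eq enn2ereal_ennreal)
  \<comment> \<open>Distributivity can fail in \<open>ereal\<close> when infinities of opposite sign
    meet; here one summand is real.\<close>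
  have split: "ereal c * (ereal u + e) = ereal (c * u) + ereal c * e" for c u e
    by (cases e; cases c "0::real" rule: linorder_cases) (auto simp: algebra_simps)
  have "ereal (?q Q3 ?Z - ln 2) + enn2ereal (?J ?Z)
    \<le> ereal (a * (?q Q1 X - ln 2) + (1 - a) * (?q Q2 Y - ln 2))
      + (ereal a * enn2ereal (?J X) + ereal (1 - a) * enn2ereal (?J Y))"
    using q by (intro add_mono J) simp
  also have "\<dots> = ereal a * (ereal (?q Q1 X - ln 2) + enn2ereal (?J X))
      + ereal (1 - a) * (ereal (?q Q2 Y - ln 2) + enn2ereal (?J Y))"
    unfolding split plus_ereal.simps(1)[symmetric] by (simp only: ac_simps)
  finally show ?thesis
    by (simp add: energy_law[OF \<Omega>] Q)
qed

theorem theorem9: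
  fixes Q1 Q2 Q3 :: "complex \<Rightarrow> real" and a :: real
  assumes "continuous_on unit_circle Q1"
    and "continuous_on unit_circle Q2"
    and "continuous_on unit_circle Q3"
    and "0 < a" and "a < 1"
    and "\<And>x y :: real. a * Q1 (cis x) + (1 - a) * Q2 (cis y) \<ge> Q3 (cis (a * x + (1 - a) * y))"
  shows "ereal a * energy Q1 (equilibrium_measure Q1)
           + ereal (1 - a) * energy Q2 (equilibrium_measure Q2)
         \<ge> energy Q3 (equilibrium_measure Q3)"
proof -
  let ?\<Omega> = "restrict_space lborel {0<..<1::real}"
  have \<Omega>: "prob_space ?\<Omega>"
    by (auto simp: emeasure_restrict_space space_restrict_space intro!: prob_spaceI)
  obtain X where X: "X \<in> borel_measurable ?\<Omega>" "mono_on {0<..<1} X"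
    "\<And>\<omega>. \<omega> \<in> {0<..<1} \<Longrightarrow> X \<omega> \<in> {-pi..pi}"
    and \<mu>1: "equilibrium_measure Q1 = distr ?\<Omega> circle_borel (\<lambda>\<omega>. cis (X \<omega>))"
    using circle_prob_eq_quantile_law[OF equilibrium_measure_minimizes(1)[OF assms(1)]] by blast
  obtain Y where Y: "Y \<in> borel_measurable ?\<Omega>" "mono_on {0<..<1} Y"
    "\<And>\<omega>. \<omega> \<in> {0<..<1} \<Longrightarrow> Y \<omega> \<in> {-pi..pi}"
    and \<mu>2: "equilibrium_measure Q2 = distr ?\<Omega> circle_borel (\<lambda>\<omega>. cis (Y \<omega>))"
    using circle_prob_eq_quantile_law[OF equilibrium_measure_minimizes(1)[OF assms(2)]] by blast
  \<comment> \<open>Whichever of \<open>s\<close> and \<open>t\<close> is smaller, both increasing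
    functions respect that order.\<close>
  have comon: "(X s \<le> X t \<and> Y s \<le> Y t) \<or> (X t \<le> X s \<and> Y t \<le> Y s)"
    if "s \<in> space ?\<Omega>" "t \<in> space ?\<Omega>" for s t
    using that linear[of s t] mono_onD[OF X(2)] mono_onD[OF Y(2)] by (auto simp: space_restrict_space)
  note [measurable] = X(1) Y(1)
  \<comment> \<open>The law of the combined angle is a competitor in the minimization for
    \<open>Q3\<close>.\<close>
  have "energy Q3 (equilibrium_measure Q3)
    \<le> energy Q3 (distr ?\<Omega> circle_borel (\<lambda>\<omega>. cis (a * X \<omega> + (1 - a) * Y \<omega>)))"
    by (intro equilibrium_measure_minimizes(2)[OF assms(3)] law_mem_circle_prob[OF \<Omega>]) measurable
  also have "\<dots> \<le> ereal a * energy Q1 (equilibrium_measure Q1)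
      + ereal (1 - a) * energy Q2 (equilibrium_measure Q2)"
    unfolding \<mu>1 \<mu>2
    by (rule energy_comonotone_combination[OF \<Omega> X(1) Y(1) _ comon assms])
      (use X(3) Y(3) in \<open>auto simp: space_restrict_space\<close>)
  finally show ?thesis .
qed

end
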